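(* Let $X$ and $Y$ be two quasi-metric spaces. Then $$d_{GH}(X,Y)=\frac{1}{2}\inf\{\operatorname{dis}\mathcal R\mid\mathcal R\subseteq X\times Y\text{ is a correspondence}\}.$$
   Context: A quasi-metric space is a set $X$ with a map $d\colon X\times X\to[0,\infty)$ such that $d(x,y)\leq d(x,z)+d(z,y)$ for all $x,y,z\in X$, and, for all $x,y\in X$, $d(x,y)=d(y,x)=0$ if and only if $x=y$ (symmetry is not required). Its symmetrisation is the metric $d^s(x,y)=\max\{d(x,y),d(y,x)\}$. An isometric embedding is a map preserving the quasi-metric. Gromov-Hausdorff distance for quasi-metric spaces: for a quasi-metric space $(Z,d)$ and $A,B\subseteq Z$, let $d_H^{\mathrm{Sym}}(A,B)\in[0,\infty]$ be the Hausdorff distance of $A$ and $B$ in the metric space $(Z,d^s)$, i.e. the infimum of the $r\geq 0$ such that every $a\in A$ has some $b\in B$ with $d^s(a,b)\leq r$ and every $b\in B$ has some $a\in A$ with $d^s(a,b)\le r$. Then $d_{GH}(X,Y)\in[0,\infty]$ is the infimum of the $\varepsilon>0$ for which there exist a quasi-metric space $Z$ and isometric embeddings $i_X\colon X\to Z$, $i_Y\colon Y\to Z$ with $d_H^{\mathrm{Sym}}(i_X(X),i_Y(Y))<\varepsilon$. The infimum of the empty set is $\infty$. A relation $\mathcal R\subseteq X\times Y$ is a correspondence if its projections to $X$ and to $Y$ are both surjective. Its distortion is $\operatorname{dis}\mathcal R=\sup\{|d_X(x,x')-d_Y(y,y')|\mid (x,y),(x',y')\in\mathcal R\}\in[0,\infty]$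 (supremum taken in $[0,\infty]$). *)

theory Defs
  imports "HOL-Library.Extended_Nonnegative_Real"
begin

locale quasi_metric_space =
  fixes X :: "'a set" and d :: "'a \<Rightarrow> 'a \<Rightarrow> real"
  assumes nonneg: "x \<in> X \<Longrightarrow> y \<in> X \<Longrightarrow> 0 \<le> d x y"
    and triangle: "x \<in> X \<Longrightarrow> y \<in> X \<Longrightarrow> z \<in> X \<Longrightarrow> d x y \<le> d x z + d z y"
    and separation: "x \<in> X \<Longrightarrow> y \<in> X \<Longrightarrow> d x y = 0 \<and> d y x = 0 \<longleftrightarrow> x = y"

definition symmetrisation :: "('a \<Rightarrow> 'a \<Rightarrow> real) \<Rightarrow> 'a \<Rightarrow> 'a \<Rightarrow> real" where
  "symmetrisation d x y = max (d x y) (d y x)"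

definition isometric_embedding ::
  "'a set \<Rightarrow> ('a \<Rightarrow> 'a \<Rightarrow> real) \<Rightarrow> 'z set \<Rightarrow> ('z \<Rightarrow> 'z \<Rightarrow> real) \<Rightarrow> ('a \<Rightarrow> 'z) \<Rightarrow> bool" where
  "isometric_embedding X dX Z dZ i \<longleftrightarrow>
     i ` X \<subseteq> Z \<and> (\<forall>x\<in>X. \<forall>x'\<in>X. dZ (i x) (i x') = dX x x')"

definition hausdorff_dist :: "('z \<Rightarrow> 'z \<Rightarrow> real) \<Rightarrow> 'z set \<Rightarrow> 'z set \<Rightarrow> ennreal" where
  "hausdorff_dist m A B =
     Inf {ennreal r | r. 0 \<le> r \<and> (\<forall>a\<in>A. \<exists>b\<in>B. m a b \<le> r) \<and> (\<forall>b\<in>B. \<exists>a\<in>A. m a b \<le> r)}"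

definition hausdorff_dist_sym :: "('z \<Rightarrow> 'z \<Rightarrow> real) \<Rightarrow> 'z set \<Rightarrow> 'z set \<Rightarrow> ennreal" where
  "hausdorff_dist_sym d = hausdorff_dist (symmetrisation d)"

text \<open>
  The ambient spaces \<open>Z\<close> in the Gromov-Hausdorff distance range over all quasi-metric spaces.
  As HOL cannot quantify over types inside a formula, \<open>gh_dist_in\<close> takes the type \<open>'z\<close> of the
  points of \<open>Z\<close> as a parameter, and \<open>gh_dist\<close> takes the type \<open>'a + 'b\<close>. Nothing is lost: by
  \<open>gh_dist_le_gh_dist_in\<close> below, no other choice of \<open>'z\<close> gives a smaller value.
\<close>

definition gh_dist_in ::
  "'z itself \<Rightarrow> 'a set \<Rightarrow> ('a \<Rightarrow> 'a \<Rightarrow> real) \<Rightarrow> 'b set \<Rightarrow> ('b \<Rightarrow> 'b \<Rightarrow> real) \<Rightarrow> ennreal" where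
  "gh_dist_in _ X dX Y dY =
     Inf {ennreal \<epsilon> | \<epsilon>. 0 < \<epsilon> \<and>
       (\<exists>(Z :: 'z set) dZ iX iY.
          quasi_metric_space Z dZ \<and>
          isometric_embedding X dX Z dZ iX \<and>
          isometric_embedding Y dY Z dZ iY \<and>
          hausdorff_dist_sym dZ (iX ` X) (iY ` Y) < ennreal \<epsilon>)}"

definition gh_dist ::
  "'a set \<Rightarrow> ('a \<Rightarrow> 'a \<Rightarrow> real) \<Rightarrow> 'b set \<Rightarrow> ('b \<Rightarrow> 'b \<Rightarrow> real) \<Rightarrow> ennreal" where
  "gh_dist = gh_dist_in TYPE('a + 'b)"

definition correspondence :: "'a set \<Rightarrow> 'b set \<Rightarrow> ('a \<times> 'b) set \<Rightarrow> bool" where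
  "correspondence X Y R \<longleftrightarrow> R \<subseteq> X \<times> Y \<and> fst ` R = X \<and> snd ` R = Y"

definition distortion ::
  "('a \<Rightarrow> 'a \<Rightarrow> real) \<Rightarrow> ('b \<Rightarrow> 'b \<Rightarrow> real) \<Rightarrow> ('a \<times> 'b) set \<Rightarrow> ennreal" where
  "distortion dX dY R =
     Sup {ennreal \<bar>dX x x' - dY y y'\<bar> | x x' y y'. (x, y) \<in> R \<and> (x', y') \<in> R}"

lemma gh_dist_le_gh_dist_in:
  fixes X :: "'a set" and Y :: "'b set"
  shows "gh_dist X dX Y dY \<le> gh_dist_in TYPE('z) X dX Y dY"
  unfolding gh_dist_def gh_dist_in_def
proof (rule Inf_superset_mono, safe)
  fix \<epsilon> :: real and Z :: "'z set" and dZ iX iY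
  assume eps: "0 < \<epsilon>" and Z: "quasi_metric_space Z dZ"
    and iX: "isometric_embedding X dX Z dZ iX" and iY: "isometric_embedding Y dY Z dZ iY"
    and h: "hausdorff_dist_sym dZ (iX ` X) (iY ` Y) < ennreal \<epsilon>"
  define W where "W = iX ` X \<union> iY ` Y"
  define j :: "'z \<Rightarrow> 'a + 'b" where
    "j w = (if w \<in> iX ` X then Inl (inv_into X iX w) else Inr (inv_into Y iY w))" for w
  define k where "k = case_sum iX iY"
  have kj: "k (j w) = w" if "w \<in> W" for w
    using that by (auto simp: k_def j_def W_def f_inv_into_f)
  have WZ: "W \<subseteq> Z"
    using iX iY by (auto simp: W_def isometric_embedding_def)
  let ?d = "\<lambda>u v. dZ (k u) (k v)"
  have WX: "iX x \<in> W" if "x \<in> X" for x using that by (auto simp: W_def)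
  have WY: "iY y \<in> W" if "y \<in> Y" for y using that by (auto simp: W_def)
  interpret Z: quasi_metric_space Z dZ by (rule Z)
  have "quasi_metric_space (j ` W) ?d"
  proof
    fix u v assume "u \<in> j ` W" "v \<in> j ` W"
    then obtain a b where ab: "u = j a" "v = j b" "a \<in> W" "b \<in> W" by blast
    with WZ show "0 \<le> ?d u v" by (auto simp: kj intro: Z.nonneg)
    from ab WZ have "?d u v = 0 \<and> ?d v u = 0 \<longleftrightarrow> a = b"
      using Z.separation[of a b] by (auto simp: kj)
    moreover have "a = b \<longleftrightarrow> u = v" using ab kj by metis
    ultimately show "?d u v = 0 \<and> ?d v u = 0 \<longleftrightarrow> u = v" by simp
  next
    fix u v w assume "u \<in> j ` W" "v \<in> j ` W" "w \<in> j ` W"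
    with WZ show "?d u v \<le> ?d u w + ?d w v" by (auto simp: kj intro!: Z.triangle)
  qed
  moreover have "isometric_embedding X dX (j ` W) ?d (j \<circ> iX)"
    using iX by (auto simp: isometric_embedding_def kj WX)
  moreover have "isometric_embedding Y dY (j ` W) ?d (j \<circ> iY)"
    using iY by (auto simp: isometric_embedding_def kj WY)
  moreover have "hausdorff_dist_sym ?d ((j \<circ> iX) ` X) ((j \<circ> iY) ` Y)
      = hausdorff_dist_sym dZ (iX ` X) (iY ` Y)"
    by (simp add: hausdorff_dist_sym_def hausdorff_dist_def symmetrisation_def kj WX WY cong: bex_cong)
  ultimately show "\<exists>\<epsilon>'. ennreal \<epsilon> = ennreal \<epsilon>' \<and> 0 < \<epsilon>' \<and>
       (\<exists>(Z :: ('a + 'b) set) dZ iX iY.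
          quasi_metric_space Z dZ \<and>
          isometric_embedding X dX Z dZ iX \<and>
          isometric_embedding Y dY Z dZ iY \<and>
          hausdorff_dist_sym dZ (iX ` X) (iY ` Y) < ennreal \<epsilon>')"
    using eps h by metis
qed

end

theory Submission imports Defs begin

text \<open>
  Both inequalities translate between isometric embeddings into a common space and
  correspondences, a Hausdorff distance of about \<open>r\<close> matching a distortion of about \<open>2 * r\<close>.

  Given embeddings whose images are at symmetrised Hausdorff distance below \<open>\<epsilon>\<close>, fix \<open>r < \<epsilon>\<close> that
  witnesses this and relate \<open>x\<close> to \<open>y\<close> when their images are at \<open>d\<^sup>s\<close>-distance at most \<open>r\<close>. This is a
  correspondence, and walking from \<open>x\<close> to \<open>x'\<close> via their partners \<open>y\<close> and \<open>y'\<close> (and conversely)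
  costs two extra steps of length at most \<open>r\<close>, so its distortion is at most \<open>2 * r\<close>
  (\<open>ex_correspondence_of_common_embedding\<close>).

  Given a correspondence of distortion at most \<open>2 * r\<close> with \<open>r > 0\<close>, the disjoint union of \<open>X\<close> and
  \<open>Y\<close> becomes a quasi-metric space when each related pair is joined by a bridge of length \<open>r\<close> in
  both directions and the distance from a point to one on the other side is the infimum of the costs
  over all bridges. The triangle inequality could only fail by a shortcut that leaves one space over
  a bridge and returns over another; but the two crossings cost \<open>2 * r\<close>, while the detour through
  the other space saves at most the distortion
  (\<open>dist_le_round_trip\<close>). As \<open>r\<close> is positive, no point of \<open>X\<close> collapses onto a point of \<open>Y\<close>. Related
  points are at symmetrised distance at most \<open>r\<close>, so the two copies are Hausdorff close
  (\<open>gh_dist_le\<close>). Letting \<open>r\<close> decrease to half the distortion yields the bound.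
\<close>

section \<open>Distortion and Hausdorff distance as bounds on points\<close>

lemma distortion_le_iff:
  assumes "0 \<le> c"
  shows "distortion dX dY R \<le> ennreal c \<longleftrightarrow>
    (\<forall>x y x' y'. (x, y) \<in> R \<longrightarrow> (x', y') \<in> R \<longrightarrow> \<bar>dX x x' - dY y y'\<bar> \<le> c)"
proof -
  have "distortion dX dY R \<le> ennreal c \<longleftrightarrow>
    (\<forall>x y x' y'. (x, y) \<in> R \<longrightarrow> (x', y') \<in> R \<longrightarrow> ennreal \<bar>dX x x' - dY y y'\<bar> \<le> ennreal c)"
    unfolding distortion_def Sup_le_iff by blast
  with assms show ?thesis by simp
qed

lemma hausdorff_dist_lessE:
  assumes "hausdorff_dist m A B < ennreal \<epsilon>"
  obtains r where "0 \<le> r" "r < \<epsilon>"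
    "\<And>a. a \<in> A \<Longrightarrow> \<exists>b\<in>B. m a b \<le> r" "\<And>b. b \<in> B \<Longrightarrow> \<exists>a\<in>A. m a b \<le> r"
proof -
  from assms obtain r where "0 \<le> r" "ennreal r < ennreal \<epsilon>"
    "\<forall>a\<in>A. \<exists>b\<in>B. m a b \<le> r" "\<forall>b\<in>B. \<exists>a\<in>A. m a b \<le> r"
    unfolding hausdorff_dist_def Inf_less_iff by blast
  with that[of r] show thesis by (auto simp: ennreal_less_iff)
qed

section \<open>From a common embedding to a correspondence\<close>

lemma (in quasi_metric_space) dist_le_via_partners:
  assumes "a \<in> X" "a' \<in> X" "b \<in> X" "b' \<in> X"
    and "d a b \<le> r" "d b' a' \<le> r"
  shows "d a a' \<le> d b b' + 2 * r"
  using triangle[of a a' b] triangle[of b a' b'] assms by linarith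

lemma ex_correspondence_of_common_embedding:
  assumes Z: "quasi_metric_space Z dZ"
    and iX: "isometric_embedding X dX Z dZ iX" and iY: "isometric_embedding Y dY Z dZ iY"
    and close: "hausdorff_dist_sym dZ (iX ` X) (iY ` Y) < ennreal \<epsilon>"
  shows "\<exists>R. correspondence X Y R \<and> distortion dX dY R \<le> ennreal (2 * \<epsilon>)"
proof -
  interpret Z: quasi_metric_space Z dZ by (rule Z)
  have inX: "iX x \<in> Z" and distX: "x' \<in> X \<Longrightarrow> dZ (iX x) (iX x') = dX x x'" if "x \<in> X" for x x'
    using iX that by (auto simp: isometric_embedding_def)
  have inY: "iY y \<in> Z" and distY: "y' \<in> Y \<Longrightarrow> dZ (iY y) (iY y') = dY y y'" if "y \<in> Y" for y y'
    using iY that by (auto simp: isometric_embedding_def)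
  obtain r where r: "0 \<le> r" "r < \<epsilon>"
    and partnerX: "\<And>a. a \<in> iX ` X \<Longrightarrow> \<exists>b\<in>iY ` Y. symmetrisation dZ a b \<le> r"
    and partnerY: "\<And>b. b \<in> iY ` Y \<Longrightarrow> \<exists>a\<in>iX ` X. symmetrisation dZ a b \<le> r"
    using hausdorff_dist_lessE[OF close[unfolded hausdorff_dist_sym_def]] by metis
  define R where "R = {(x, y) \<in> X \<times> Y. symmetrisation dZ (iX x) (iY y) \<le> r}"
  have "\<exists>y. (x, y) \<in> R" if "x \<in> X" for x
    using partnerX[of "iX x"] that by (auto simp: R_def)
  moreover have "\<exists>x. (x, y) \<in> R" if "y \<in> Y" for y
    using partnerY[of "iY y"] that by (auto simp: R_def)
  ultimately have "correspondence X Y R"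
    unfolding correspondence_def by (force simp: R_def)
  moreover have "\<bar>dX x x' - dY y y'\<bar> \<le> 2 * \<epsilon>" if "(x, y) \<in> R" "(x', y') \<in> R" for x y x' y'
  proof -
    have xy: "x \<in> X" "y \<in> Y" "x' \<in> X" "y' \<in> Y"
      and "dZ (iX x) (iY y) \<le> r" "dZ (iY y) (iX x) \<le> r"
        "dZ (iX x') (iY y') \<le> r" "dZ (iY y') (iX x') \<le> r"
      using that by (auto simp: R_def symmetrisation_def)
    then have "dX x x' \<le> dY y y' + 2 * r" "dY y y' \<le> dX x x' + 2 * r"
      using Z.dist_le_via_partners[of "iX x" "iX x'" "iY y" "iY y'" r]
        Z.dist_le_via_partners[of "iY y" "iY y'" "iX x" "iX x'" r]
      by (simp_all add: inX inY distX distY)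
    with r show ?thesis by linarith
  qed
  ultimately show ?thesis
    using r by (auto simp: distortion_le_iff intro!: exI[of _ R])
qed

section \<open>Gluing along a correspondence\<close>

text \<open>A bridge of length \<open>r\<close> joins each pair in \<open>R\<close>, and \<open>x\<close> is taken to \<open>y\<close> over one of them. Bridges are crossed in the other
  direction by exchanging the roles of the spaces and taking the converse relation, so that each
  fact below also covers the passage from \<open>Y\<close> to \<open>X\<close>.\<close>

definition bridge_dist ::
  "('a \<Rightarrow> 'a \<Rightarrow> real) \<Rightarrow> ('b \<Rightarrow> 'b \<Rightarrow> real) \<Rightarrow> ('a \<times> 'b) set \<Rightarrow> real \<Rightarrow> 'a \<Rightarrow> 'b \<Rightarrow> real" where
  "bridge_dist dX dY R r x y = (INF (x', y')\<in>R. dX x x' + r + dY y' y)"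

fun glued_dist ::
  "('a \<Rightarrow> 'a \<Rightarrow> real) \<Rightarrow> ('b \<Rightarrow> 'b \<Rightarrow> real) \<Rightarrow> ('a \<times> 'b) set \<Rightarrow> real \<Rightarrow> 'a + 'b \<Rightarrow> 'a + 'b \<Rightarrow> real"
where
  "glued_dist dX dY R r (Inl x) (Inl x') = dX x x'"
| "glued_dist dX dY R r (Inr y) (Inr y') = dY y y'"
| "glued_dist dX dY R r (Inl x) (Inr y) = bridge_dist dX dY R r x y"
| "glued_dist dX dY R r (Inr y) (Inl x) = bridge_dist dY dX (R\<inverse>) r y x"

lemma (in quasi_metric_space) dist_self: "x \<in> X \<Longrightarrow> d x x = 0"
  using separation[of x x] by simp

locale bridged_spaces =
  X: quasi_metric_space X dX + Y: quasi_metric_space Y dY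
  for X :: "'a set" and dX and Y :: "'b set" and dY +
  fixes R :: "('a \<times> 'b) set" and r :: real
  assumes corr: "correspondence X Y R"
    and r_pos: "0 < r"
    and distortion_le: "distortion dX dY R \<le> ennreal (2 * r)"
begin

lemma relatedD: "(x, y) \<in> R \<Longrightarrow> x \<in> X \<and> y \<in> Y"
  using corr by (auto simp: correspondence_def)

lemma ex_related_left: "x \<in> X \<Longrightarrow> \<exists>y. (x, y) \<in> R"
  using corr by (auto simp: correspondence_def)

lemma ex_related_right: "y \<in> Y \<Longrightarrow> \<exists>x. (x, y) \<in> R"
  using corr by (auto simp: correspondence_def)

lemma dist_diff_le: "(x, y) \<in> R \<Longrightarrow> (x', y') \<in> R \<Longrightarrow> \<bar>dX x x' - dY y y'\<bar> \<le> 2 * r"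
  using distortion_le r_pos by (simp add: distortion_le_iff)

lemma converse_bridged_spaces: "bridged_spaces Y dY X dX (R\<inverse>) r"
proof
  show "correspondence Y X (R\<inverse>)"
    using corr by (auto simp: correspondence_def simp flip: Domain_fst Range_snd)
  show "distortion dY dX (R\<inverse>) \<le> ennreal (2 * r)"
    using dist_diff_le r_pos by (simp add: distortion_le_iff abs_minus_commute)
qed (rule r_pos)

lemma bridge_dist_le:
  assumes "x \<in> X" "y \<in> Y" "(x', y') \<in> R"
  shows "bridge_dist dX dY R r x y \<le> dX x x' + r + dY y' y"
proof -
  have "bdd_below ((\<lambda>(x', y'). dX x x' + r + dY y' y) ` R)"
    using assms r_pos
    by (intro bdd_belowI2[where m = 0]) (auto dest!: relatedD intro!: add_nonneg_nonneg X.nonneg Y.nonneg)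
  from cINF_lower[OF this assms(3)] show ?thesis
    by (simp add: bridge_dist_def)
qed

text \<open>The hypothesis \<open>x \<in> X\<close> provides a bridge: over no bridges at all the infimum would be an
  unspecified real.\<close>

lemma le_bridge_dist:
  assumes "x \<in> X" "\<And>x' y'. (x', y') \<in> R \<Longrightarrow> c \<le> dX x x' + r + dY y' y"
  shows "c \<le> bridge_dist dX dY R r x y"
  unfolding bridge_dist_def using assms ex_related_left[of x]
  by (intro cINF_greatest) auto

lemma bridge_dist_pos:
  assumes "x \<in> X" "y \<in> Y"
  shows "0 < bridge_dist dX dY R r x y"
proof -
  have "r \<le> bridge_dist dX dY R r x y"
    using assms by (intro le_bridge_dist) (auto dest!: relatedD intro!: add_nonneg_nonneg X.nonneg Y.nonneg)
  with r_pos show ?thesis by linarith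
qed

lemma bridge_dist_related_le:
  assumes "(x, y) \<in> R"
  shows "bridge_dist dX dY R r x y \<le> r"
  using bridge_dist_le[of x y x y] assms relatedD[OF assms] by (simp add: X.dist_self Y.dist_self)

lemma bridge_dist_triangle_left:
  assumes "x \<in> X" "x' \<in> X" "y \<in> Y"
  shows "bridge_dist dX dY R r x y \<le> dX x x' + bridge_dist dX dY R r x' y"
proof -
  have "bridge_dist dX dY R r x y - dX x x' \<le> bridge_dist dX dY R r x' y"
  proof (rule le_bridge_dist)
    fix a b assume "(a, b) \<in> R"
    then show "bridge_dist dX dY R r x y - dX x x' \<le> dX x' a + r + dY b y"
      using bridge_dist_le[of x y a b] X.triangle[of x a x'] relatedD[of a b] assms by auto
  qed (rule assms)
  then show ?thesis by simp
qed

lemma bridge_dist_triangle_right: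
  assumes "x \<in> X" "y \<in> Y" "y' \<in> Y"
  shows "bridge_dist dX dY R r x y \<le> bridge_dist dX dY R r x y' + dY y' y"
proof -
  have "bridge_dist dX dY R r x y - dY y' y \<le> bridge_dist dX dY R r x y'"
  proof (rule le_bridge_dist)
    fix a b assume "(a, b) \<in> R"
    then show "bridge_dist dX dY R r x y - dY y' y \<le> dX x a + r + dY b y'"
      using bridge_dist_le[of x y a b] Y.triangle[of b y y'] relatedD[of a b] assms by auto
  qed (rule assms)
  then show ?thesis by simp
qed

text \<open>This is where the bridges must not be shorter than half the distortion. A round trip leaves
  over a bridge \<open>(a, b)\<close> and returns over a bridge \<open>(a', b')\<close>. Its part in \<open>Y\<close> has length at least
  \<open>dY b b'\<close>, which together with the two crossings is at least \<open>dX a a'\<close>.\<close>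

lemma dist_le_round_trip:
  assumes "x \<in> X" "x' \<in> X" "y \<in> Y"
  shows "dX x x' \<le> bridge_dist dX dY R r x y + bridge_dist dY dX (R\<inverse>) r y x'"
proof -
  interpret conv: bridged_spaces Y dY X dX "R\<inverse>" r by (rule converse_bridged_spaces)
  have "dX x x' - bridge_dist dY dX (R\<inverse>) r y x' \<le> bridge_dist dX dY R r x y"
  proof (rule le_bridge_dist)
    fix a b assume ab: "(a, b) \<in> R"
    have "dX x x' - (dX x a + r + dY b y) \<le> bridge_dist dY dX (R\<inverse>) r y x'"
    proof (rule conv.le_bridge_dist)
      fix b' a' assume "(b', a') \<in> R\<inverse>"
      then have ab': "(a', b') \<in> R" by simp
      have "dX x x' \<le> dX x a + dX a a' + dX a' x'"
        using X.triangle[of x x' a] X.triangle[of a x' a'] relatedD[OF ab] relatedD[OF ab'] assms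
        by auto
      moreover have "dX a a' \<le> dY b b' + 2 * r"
        using dist_diff_le[OF ab ab'] by linarith
      moreover have "dY b b' \<le> dY b y + dY y b'"
        using Y.triangle[of b b' y] relatedD[OF ab] relatedD[OF ab'] assms by auto
      ultimately show "dX x x' - (dX x a + r + dY b y) \<le> dY y b' + r + dX a' x'"
        by linarith
    qed (rule assms)
    then show "dX x x' - bridge_dist dY dX (R\<inverse>) r y x' \<le> dX x a + r + dY b y"
      by linarith
  qed (rule assms)
  then show ?thesis by simp
qed

lemma quasi_metric_space_glued: "quasi_metric_space (Inl ` X \<union> Inr ` Y) (glued_dist dX dY R r)"
proof -
  interpret conv: bridged_spaces Y dY X dX "R\<inverse>" r by (rule converse_bridged_spaces)
  have crossing: "0 \<le> bridge_dist dX dY R r x y" "bridge_dist dX dY R r x y \<noteq> 0"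
    "0 \<le> bridge_dist dY dX (R\<inverse>) r y x" "bridge_dist dY dX (R\<inverse>) r y x \<noteq> 0"
    if "x \<in> X" "y \<in> Y" for x y
    using bridge_dist_pos[of x y] conv.bridge_dist_pos[of y x] that by linarith+
  note conv_round_trip = conv.dist_le_round_trip[unfolded converse_converse]
  show ?thesis
  proof
    fix u v assume "u \<in> Inl ` X \<union> Inr ` Y" "v \<in> Inl ` X \<union> Inr ` Y"
    then show "0 \<le> glued_dist dX dY R r u v"
      and "glued_dist dX dY R r u v = 0 \<and> glued_dist dX dY R r v u = 0 \<longleftrightarrow> u = v"
      by (elim UnE imageE; simp add: crossing X.nonneg Y.nonneg X.separation Y.separation)+
  next
    fix u v w
    assume "u \<in> Inl ` X \<union> Inr ` Y" "v \<in> Inl ` X \<union> Inr ` Y" "w \<in> Inl ` X \<union> Inr ` Y"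
    then show "glued_dist dX dY R r u v \<le> glued_dist dX dY R r u w + glued_dist dX dY R r w v"
      by (elim UnE imageE)
        (simp_all add: X.triangle Y.triangle dist_le_round_trip conv_round_trip
          bridge_dist_triangle_left bridge_dist_triangle_right
          conv.bridge_dist_triangle_left conv.bridge_dist_triangle_right)
  qed
qed

lemma symmetrisation_glued_related_le:
  assumes "(x, y) \<in> R"
  shows "symmetrisation (glued_dist dX dY R r) (Inl x) (Inr y) \<le> r"
proof -
  interpret conv: bridged_spaces Y dY X dX "R\<inverse>" r by (rule converse_bridged_spaces)
  show ?thesis
    using bridge_dist_related_le[of x y] conv.bridge_dist_related_le[of y x] assms
    by (simp add: symmetrisation_def)
qed

lemma hausdorff_dist_glued_le:
  "hausdorff_dist_sym (glued_dist dX dY R r) (Inl ` X) (Inr ` Y) \<le> ennreal r"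
  unfolding hausdorff_dist_sym_def hausdorff_dist_def
proof (rule Inf_lower, intro CollectI exI conjI ballI)
  fix a :: "'a + 'b" assume "a \<in> Inl ` X"
  then obtain x y where "a = Inl x" "(x, y) \<in> R" by (auto dest: ex_related_left)
  then show "\<exists>b\<in>Inr ` Y. symmetrisation (glued_dist dX dY R r) a b \<le> r"
    using symmetrisation_glued_related_le[of x y] relatedD[of x y] by auto
next
  fix b :: "'a + 'b" assume "b \<in> Inr ` Y"
  then obtain x y where "b = Inr y" "(x, y) \<in> R" by (auto dest: ex_related_right)
  then show "\<exists>a\<in>Inl ` X. symmetrisation (glued_dist dX dY R r) a b \<le> r"
    using symmetrisation_glued_related_le[of x y] relatedD[of x y] by auto
qed (use r_pos in auto)

lemma gh_dist_le:
  assumes "r < \<epsilon>"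
  shows "gh_dist X dX Y dY \<le> ennreal \<epsilon>"
  unfolding gh_dist_def gh_dist_in_def
proof (rule Inf_lower, intro CollectI exI conjI)
  show "isometric_embedding X dX (Inl ` X \<union> Inr ` Y) (glued_dist dX dY R r) Inl"
    and "isometric_embedding Y dY (Inl ` X \<union> Inr ` Y) (glued_dist dX dY R r) Inr"
    by (auto simp: isometric_embedding_def)
  show "hausdorff_dist_sym (glued_dist dX dY R r) (Inl ` X) (Inr ` Y) < ennreal \<epsilon>"
    by (rule le_less_trans[OF hausdorff_dist_glued_le]) (use assms r_pos in \<open>simp add: ennreal_lessI\<close>)
qed (use assms r_pos in \<open>simp_all add: quasi_metric_space_glued\<close>)

end

section \<open>The Gromov-Hausdorff distance in terms of distortion\<close>

lemma two_gh_dist_le_distortion: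
  assumes "quasi_metric_space X dX" "quasi_metric_space Y dY" "correspondence X Y R"
  shows "2 * gh_dist X dX Y dY \<le> distortion dX dY R"
proof (rule ennreal_le_epsilon)
  fix e :: real
  assume "distortion dX dY R < top" and e: "0 < e"
  then obtain \<delta> where \<delta>: "0 \<le> \<delta>" "distortion dX dY R = ennreal \<delta>"
    by (cases "distortion dX dY R") auto
  \<comment> \<open>The slack \<open>e\<close> is spent twice: the bridges need a positive length even if the distortion
    vanishes, and that length must stay strictly below the bound \<open>(\<delta> + e) / 2\<close>.\<close>
  define r where "r = \<delta> / 2 + e / 4"
  have "bridged_spaces X dX Y dY R r"
    using assms \<delta> e
    by (simp add: bridged_spaces_def bridged_spaces_axioms_def r_def add_nonneg_pos ennreal_leI)
  then have "gh_dist X dX Y dY \<le> ennreal ((\<delta> + e) / 2)"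
    using e by (intro bridged_spaces.gh_dist_le[where r = r]) (auto simp: r_def field_simps)
  then have "2 * gh_dist X dX Y dY \<le> ennreal 2 * ennreal ((\<delta> + e) / 2)"
    by (intro mult_mono) auto
  also have "\<dots> = ennreal \<delta> + ennreal e"
    using \<delta> e by (simp add: field_simps flip: ennreal_mult ennreal_plus del: ennreal_numeral)
  finally show "2 * gh_dist X dX Y dY \<le> distortion dX dY R + ennreal e"
    by (simp add: \<delta>)
qed

lemma half_Inf_distortion_le_gh_dist:
  "(1 / 2) * Inf {distortion dX dY R | R. correspondence X Y R} \<le> gh_dist X dX Y dY"
  unfolding gh_dist_def gh_dist_in_def
proof (rule Inf_greatest, safe)
  fix \<epsilon> :: real and Z :: "('a + 'b) set" and dZ iX iY
  assume "0 < \<epsilon>" and "quasi_metric_space Z dZ"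
    "isometric_embedding X dX Z dZ iX" "isometric_embedding Y dY Z dZ iY"
    "hausdorff_dist_sym dZ (iX ` X) (iY ` Y) < ennreal \<epsilon>"
  from ex_correspondence_of_common_embedding[OF this(2-)]
  obtain R where "correspondence X Y R" "distortion dX dY R \<le> ennreal (2 * \<epsilon>)"
    by blast
  then have "Inf {distortion dX dY R | R. correspondence X Y R} \<le> ennreal (2 * \<epsilon>)"
    by (blast intro: Inf_lower2)
  then have "(1 / 2) * Inf {distortion dX dY R | R. correspondence X Y R} \<le> (1 / 2) * ennreal (2 * \<epsilon>)"
    by (rule mult_left_mono) simp
  also have "(1 / 2) * ennreal (2 * \<epsilon>) = ennreal (1 / 2) * ennreal (2 * \<epsilon>)"
    using divide_ennreal[of 1 2] by simp
  also have "\<dots> = ennreal \<epsilon>"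
    using \<open>0 < \<epsilon>\<close> by (subst ennreal_mult[symmetric]) auto
  finally show "(1 / 2) * Inf {distortion dX dY R | R. correspondence X Y R} \<le> ennreal \<epsilon>" .
qed

theorem proposition3p5:
  fixes X :: "'a set" and dX :: "'a \<Rightarrow> 'a \<Rightarrow> real"
    and Y :: "'b set" and dY :: "'b \<Rightarrow> 'b \<Rightarrow> real"
  assumes "quasi_metric_space X dX" and "quasi_metric_space Y dY"
  shows "gh_dist X dX Y dY = (1 / 2) * Inf {distortion dX dY R | R. correspondence X Y R}"
proof (rule antisym)
  have "2 * gh_dist X dX Y dY \<le> Inf {distortion dX dY R | R. correspondence X Y R}"
    using two_gh_dist_le_distortion[OF assms] by (blast intro: Inf_greatest)
  then have "(1 / 2) * (2 * gh_dist X dX Y dY)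
      \<le> (1 / 2) * Inf {distortion dX dY R | R. correspondence X Y R}"
    by (rule mult_left_mono) simp
  moreover have "(1 / 2) * (2 * gh_dist X dX Y dY) = gh_dist X dX Y dY"
    by (simp add: mult.assoc[symmetric] ennreal_divide_times)
  ultimately show "gh_dist X dX Y dY \<le> (1 / 2) * Inf {distortion dX dY R | R. correspondence X Y R}"
    by simp
qed (rule half_Inf_distortion_le_gh_dist)

end
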